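(* Let $U\subset\mathbb{R}^n$ be open and convex, let $h_1,\dots,h_k:U\to\mathbb{R}$ be convex, and suppose there exists a locally Lipschitz function $g:U\to\mathbb{R}^n\setminus\{0\}$ such that $u:U\to\mathbb{R}$ is a regular solution to $\nabla u(x)=\lambda(x)g(x)$. Suppose that there exists $x^+\in U$ such that $h_i(x^+)<0$ for all $i\in\{1,\dots,k\}$. Consider the optimization problem of minimizing $u(x)$ subject to $x\in U$ and $h_1(x)\le 0,\dots,h_k(x)\le 0$. If $u$ is quasi-convex, then $x^*\in U$ is a solution to this problem if and only if $h_i(x^* )\le 0$ for all $i\in\{1,\dots,k\}$ and there exist $\lambda_1,\dots,\lambda_k\ge 0$ such that $$-g(x^* )\in\sum_{i=1}^k\lambda_i\,\partial h_i(x^* )$$ and $\lambda_ih_i(x^* )=0$ for all $i\in\{1,\dots,k\}$.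
   Context: A function on an open set is locally Lipschitz if it is Lipschitz on every compact subset. Manifolds are embedded submanifolds of Euclidean space: $X\subset\mathbb{R}^N$ is an $m$-dimensional $C^1$ manifold if each point of $X$ has a relatively open neighborhood in $X$ that is $C^1$ diffeomorphic to an open subset of $\mathbb{R}^m$. $T_x(X)$ denotes the tangent space as a linear subspace of $\mathbb{R}^N$. A vector field $g$ is a normal vector field of $X$ if $g(x)\cdot v=0$ for all $x\in X$, $v\in T_x(X)$. The level sets of $u:V\to\mathbb{R}$ are the sets $u^{-1}(u(x))$, $x\in V$. Normal solution: for $g:U\to\mathbb{R}^n\setminus\{0\}$ locally Lipschitz, a function $u:V\to\mathbb{R}$ is a normal solution to $\nabla u(x)=\lambda(x)g(x)$ if 1) $V$ is open and $V\subset U$; 2) $u$ is locally Lipschitz; 3) every level set of $u$ is an $(n-1)$-dimensional $C^1$ manifold; 4) $g$ is a normal vector field of every level set of $u$; 5) $u$ has no local maximum point and no local minimum point; 6) if $u$ is differentiable at $x$, then $\nabla u(x)\neq 0$. Regular solution: a normal solution $u:V\to\mathbb{R}$ such that $V$ is connected and, for every $x\in V$, the function $t\mapsto u(x+tg(x))$ is strictly increasing on some open interval containing $0$. $u$ is quasi-convex on a convex set $C$ if $u((1-t)x+ty)\le\max\{u(x),u(y)\}$ for all $x,y\in C$, $t\in[0,1]$. For a convex function $f:U\to\mathbb{R}$, the subdifferential is $\partial f(x)=\{p\in\mathbb{R}^n\mid f(y)-f(x)\ge p\cdot(y-x)\text{ for all }y\in U\}$. *)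

theory Defs
  imports "HOL-Analysis.Analysis"
begin

definition locally_lipschitz_on :: "'a::metric_space set \<Rightarrow> ('a \<Rightarrow> 'b::metric_space) \<Rightarrow> bool"
  where "locally_lipschitz_on V f \<longleftrightarrow>
    (\<forall>K. compact K \<and> K \<subseteq> V \<longrightarrow> (\<exists>L. L-lipschitz_on K f))"


section \<open>Embedded submanifolds of class \<open>C\<^sup>1\<close>\<close>

text \<open>
  A map on an arbitrary subset of a Euclidean space is \<open>C\<^sup>1\<close> if near every point of the
  subset it is the restriction of a \<open>C\<^sup>1\<close> map defined on an open set of the ambient space.
\<close>

definition C1_map_on :: "'a::euclidean_space set \<Rightarrow> ('a \<Rightarrow> 'b::euclidean_space) \<Rightarrow> bool"
  where "C1_map_on S f \<longleftrightarrow>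
    (\<forall>x\<in>S. \<exists>N F F'. open N \<and> x \<in> N \<and>
       (\<forall>y\<in>N. (F has_derivative blinfun_apply (F' y)) (at y)) \<and>
       continuous_on N F' \<and> (\<forall>y\<in>N \<inter> S. F y = f y))"

definition C1_diffeomorphic :: "'a::euclidean_space set \<Rightarrow> 'b::euclidean_space set \<Rightarrow> bool"
  where "C1_diffeomorphic S T \<longleftrightarrow>
    (\<exists>\<phi> \<psi>. homeomorphism S T \<phi> \<psi> \<and> C1_map_on S \<phi> \<and> C1_map_on T \<psi>)"

text \<open>
  The dimension \<open>m\<close> is a number depending on the ambient space (and may be 0), so the parameter
  space \<open>\<real>\<^sup>m\<close> cannot be a type. It is represented by an \<open>m\<close>-dimensional linear subspace \<open>P\<close> of
  the ambient space, and an open subset of \<open>\<real>\<^sup>m\<close> by a relatively open subset of \<open>P\<close>. Such a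
  \<open>P\<close> exists whenever \<open>m\<close> is at most the ambient dimension; for larger \<open>m\<close> only the empty set is
  an \<open>m\<close>-dimensional manifold, as it should be.
\<close>

definition C1_manifold :: "nat \<Rightarrow> 'a::euclidean_space set \<Rightarrow> bool"
  where "C1_manifold m X \<longleftrightarrow>
    (\<forall>x\<in>X. \<exists>N P W. openin (top_of_set X) N \<and> x \<in> N \<and>
       subspace (P :: 'a set) \<and> dim P = m \<and> openin (top_of_set P) W \<and>
       C1_diffeomorphic N W)"

text \<open>The tangent space consists of the velocities of the \<open>C\<^sup>1\<close> curves in \<open>X\<close> through \<open>x\<close>.\<close>

definition tangent_space :: "'a::euclidean_space set \<Rightarrow> 'a \<Rightarrow> 'a set"
  where "tangent_space X x =
    {v. \<exists>e>0. \<exists>\<gamma>. \<gamma> C1_differentiable_on {-e<..<e} \<and> \<gamma> ` {-e<..<e} \<subseteq> X \<and>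
          \<gamma> 0 = x \<and> (\<gamma> has_vector_derivative v) (at 0)}"

definition normal_vector_field :: "'a::euclidean_space set \<Rightarrow> ('a \<Rightarrow> 'a) \<Rightarrow> bool"
  where "normal_vector_field X g \<longleftrightarrow> (\<forall>x\<in>X. \<forall>v\<in>tangent_space X x. g x \<bullet> v = 0)"


section \<open>Normal and regular solutions of \<open>\<nabla>u(x) = \<lambda>(x) g(x)\<close>\<close>

definition level_set :: "'a set \<Rightarrow> ('a \<Rightarrow> 'b) \<Rightarrow> 'a \<Rightarrow> 'a set"
  where "level_set V u x = {y \<in> V. u y = u x}"

definition local_max_point :: "'a::topological_space set \<Rightarrow> ('a \<Rightarrow> real) \<Rightarrow> 'a \<Rightarrow> bool"
  where "local_max_point V u x \<longleftrightarrow> x \<in> V \<and> eventually (\<lambda>y. u y \<le> u x) (at x within V)"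

definition local_min_point :: "'a::topological_space set \<Rightarrow> ('a \<Rightarrow> real) \<Rightarrow> 'a \<Rightarrow> bool"
  where "local_min_point V u x \<longleftrightarrow> x \<in> V \<and> eventually (\<lambda>y. u x \<le> u y) (at x within V)"

text \<open>\<open>U\<close> is the domain of the given field \<open>g\<close>, and \<open>V\<close> is the domain of the solution \<open>u\<close>.\<close>

definition normal_solution ::
    "'a::euclidean_space set \<Rightarrow> ('a \<Rightarrow> 'a) \<Rightarrow> 'a set \<Rightarrow> ('a \<Rightarrow> real) \<Rightarrow> bool"
  where "normal_solution U g V u \<longleftrightarrow>
    open V \<and> V \<subseteq> U \<and>
    locally_lipschitz_on V u \<and>
    (\<forall>x\<in>V. C1_manifold (DIM('a) - 1) (level_set V u x)) \<and>
    (\<forall>x\<in>V. normal_vector_field (level_set V u x) g) \<and>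
    (\<nexists>x. local_max_point V u x) \<and> (\<nexists>x. local_min_point V u x) \<and>
    (\<forall>x\<in>V. \<forall>p. GDERIV u x :> p \<longrightarrow> p \<noteq> 0)"

definition regular_solution ::
    "'a::euclidean_space set \<Rightarrow> ('a \<Rightarrow> 'a) \<Rightarrow> 'a set \<Rightarrow> ('a \<Rightarrow> real) \<Rightarrow> bool"
  where "regular_solution U g V u \<longleftrightarrow>
    normal_solution U g V u \<and> connected V \<and>
    (\<forall>x\<in>V. \<exists>a b. a < 0 \<and> 0 < b \<and> (\<forall>t\<in>{a<..<b}. x + t *\<^sub>R g x \<in> V) \<and>
       strict_mono_on {a<..<b} (\<lambda>t. u (x + t *\<^sub>R g x)))"


section \<open>Convexity notions\<close>

definition quasiconvex_on :: "'a::real_vector set \<Rightarrow> ('a \<Rightarrow> real) \<Rightarrow> bool"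
  where "quasiconvex_on C u \<longleftrightarrow>
    (\<forall>x\<in>C. \<forall>y\<in>C. \<forall>t\<in>{0..1}. u ((1 - t) *\<^sub>R x + t *\<^sub>R y) \<le> max (u x) (u y))"

definition subdifferential :: "'a::real_inner set \<Rightarrow> ('a \<Rightarrow> real) \<Rightarrow> 'a \<Rightarrow> 'a set"
  where "subdifferential U f x = {p. \<forall>y\<in>U. f y - f x \<ge> p \<bullet> (y - x)}"

end

theory Submission
  imports Defs
begin

text \<open>
  The tangent space of a level set has dimension \<open>n - 1\<close>, so it is all of \<open>g(x)\<^sup>\<bottom>\<close>, and every
  functional supporting the open convex set \<open>{u < u(x)}\<close> at \<open>x\<close> is a positive multiple of \<open>g(x)\<close>.
  Separating \<open>{u < u(x)}\<close> from \<open>{x}\<close> gives \<open>g(x) \<cdot> (y - x) < 0\<close> whenever \<open>u(y) < u(x)\<close>, whence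
  sufficiency. Separating it from the feasible set shows that a minimizer of \<open>u\<close> also minimizes
  the linear function \<open>g(x\<^sup>*) \<cdot> y\<close> over the feasible set; multipliers for this convex program are
  found one constraint at a time, and the sum rule for subdifferentials yields necessity.
\<close>

section \<open>Continuity of solutions and tangent spaces of manifolds\<close>

lemma locally_lipschitz_on_imp_continuous_on:
  fixes f :: "'a::euclidean_space \<Rightarrow> 'b::metric_space"
  assumes "open V" "locally_lipschitz_on V f"
  shows "continuous_on V f"
proof (rule continuous_at_imp_continuous_on, rule ballI)
  fix x assume "x \<in> V"
  then obtain e where e: "e > 0" "cball x e \<subseteq> V"
    using assms(1) open_contains_cball by blast
  then obtain L where "L-lipschitz_on (cball x e) f"
    using assms(2) unfolding locally_lipschitz_on_def by (meson compact_cball)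
  then have "continuous_on (cball x e) f"
    by (rule lipschitz_on_continuous_on)
  then show "isCont f x"
    using e(1) by (auto intro: continuous_on_interior)
qed

lemma line_has_vector_derivative:
  fixes a w :: "'a::euclidean_space"
  assumes "(F has_derivative F') (at (a + t *\<^sub>R w))"
  shows "((\<lambda>t. F (a + t *\<^sub>R w)) has_vector_derivative F' w) (at t)"
proof -
  have "((\<lambda>t. a + t *\<^sub>R w) has_vector_derivative w) (at t)"
    by (auto intro!: derivative_eq_intros)
  from vector_derivative_diff_chain_within[OF this has_derivative_at_withinI[OF assms]]
  show ?thesis by (simp add: o_def)
qed

text \<open>The differential \<open>F' a\<close> of an inverse chart sends each \<open>w\<close> in
  \<open>P\<close> to the velocity of the image in \<open>X\<close> of the line through
  \<open>a\<close> in direction \<open>w\<close>. It is injective on \<open>P\<close> because the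
  differential of the chart inverts it, so the image of \<open>P\<close> has dimension
  \<open>m\<close>. A subspace of full dimension is enough to determine the normal
  direction.\<close>

lemma tangent_space_contains_subspace:
  fixes X :: "'a::euclidean_space set"
  assumes "C1_manifold m X" "x \<in> X"
  obtains T where "subspace T" "dim T = m" "T \<subseteq> tangent_space X x"
proof -
  obtain N P W where N: "openin (top_of_set X) N" "x \<in> N"
    and P: "subspace (P :: 'a set)" "dim P = m" and W: "openin (top_of_set P) W"
    and "C1_diffeomorphic N W"
    using assms unfolding C1_manifold_def by blast
  then obtain \<phi> \<psi> where hom: "homeomorphism N W \<phi> \<psi>" and C1: "C1_map_on N \<phi>" "C1_map_on W \<psi>"
    unfolding C1_diffeomorphic_def by blast
  define a where "a = \<phi> x"
  have aW: "a \<in> W" and \<psi>a: "\<psi> a = x"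
    using hom N(2) by (auto simp: a_def homeomorphism_def)
  have WP: "W \<subseteq> P" using W by (auto simp: openin_contains_ball)
  obtain M F F' where M: "open M" "a \<in> M"
    and F: "\<And>y. y \<in> M \<Longrightarrow> (F has_derivative blinfun_apply (F' y)) (at y)"
    and cF: "continuous_on M F'" and F\<psi>: "\<And>y. y \<in> M \<inter> W \<Longrightarrow> F y = \<psi> y"
    using C1(2) aW unfolding C1_map_on_def by metis
  obtain K G G' where K: "open K" "x \<in> K"
    and G: "\<And>y. y \<in> K \<Longrightarrow> (G has_derivative blinfun_apply (G' y)) (at y)"
    and G\<phi>: "\<And>y. y \<in> K \<inter> N \<Longrightarrow> G y = \<phi> y"
    using C1(1) N(2) unfolding C1_map_on_def by metis
  have Fa: "F a = x" using F\<psi> M aW \<psi>a by auto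
  obtain d1 where d1: "d1 > 0" "ball a d1 \<inter> P \<subseteq> W"
    using W aW by (auto simp: openin_contains_ball)
  obtain d2 where d2: "d2 > 0" "ball a d2 \<subseteq> M"
    using M open_contains_ball by blast
  have "isCont F a" using F[OF M(2)] has_derivative_continuous by blast
  then have "eventually (\<lambda>y. F y \<in> K) (nhds a)"
    using K Fa by (metis continuous_within tendsto_at_iff_tendsto_nhds topological_tendstoD)
  then obtain d3 where d3: "d3 > 0" "\<And>y. dist y a < d3 \<Longrightarrow> F y \<in> K"
    by (auto simp: eventually_nhds_metric)
  \<comment> \<open>Within distance \<open>d\<close> of \<open>a\<close>, points of \<open>P\<close>
    lie in \<open>W\<close>, the extension \<open>F\<close> of \<open>\<psi>\<close> is
    differentiable, and its values lie in \<open>K\<close>, where the extension \<open>G\<close> of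
    \<open>\<phi>\<close> is differentiable.\<close>
  define d where "d = min d1 (min d2 d3)"
  have d: "d > 0" using d1 d2 d3 by (simp add: d_def)
  have tangent: "blinfun_apply (F' a) w \<in> tangent_space X x"
    and inverse: "blinfun_apply (G' x) (blinfun_apply (F' a) w) = w" if w: "w \<in> P" for w
  proof -
    \<comment> \<open>The added 1 keeps the quotient meaningful for \<open>w = 0\<close>.\<close>
    define e where "e = d / (norm w + 1)"
    have e: "e > 0" using d by (simp add: e_def add_nonneg_pos)
    have near: "dist (a + t *\<^sub>R w) a < d" if "t \<in> {-e<..<e}" for t
    proof -
      have "\<bar>t\<bar> * norm w \<le> \<bar>t\<bar> * (norm w + 1)" by (simp add: mult_left_mono)
      also have "\<dots> < e * (norm w + 1)"
        using that by (intro mult_strict_right_mono) (auto simp: add_nonneg_pos)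
      also have "\<dots> = d" by (simp add: e_def add_nonneg_eq_0_iff)
      finally show ?thesis by (simp add: dist_norm)
    qed
    have inW: "a + t *\<^sub>R w \<in> W \<inter> M" and inK: "F (a + t *\<^sub>R w) \<in> K" if "t \<in> {-e<..<e}" for t
      using near[OF that] d1(2) d2(2) d3(2) P(1) w WP aW
      by (auto simp: d_def dist_commute subset_iff subspace_add subspace_scale)
    define \<gamma> where "\<gamma> t = F (a + t *\<^sub>R w)" for t :: real
    have \<gamma>': "(\<gamma> has_vector_derivative F' (a + t *\<^sub>R w) w) (at t)" if "t \<in> {-e<..<e}" for t
      unfolding \<gamma>_def using inW[OF that] by (intro line_has_vector_derivative F) auto
    have \<gamma>N: "\<gamma> t \<in> N" "\<phi> (\<gamma> t) = a + t *\<^sub>R w" if "t \<in> {-e<..<e}" for t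
      using inW[OF that] F\<psi>[of "a + t *\<^sub>R w"] hom by (auto simp: \<gamma>_def homeomorphism_def)
    have "continuous_on {-e<..<e} (\<lambda>t. F' (a + t *\<^sub>R w))"
      by (rule continuous_on_compose2[OF cF]) (use inW in \<open>auto intro!: continuous_intros\<close>)
    then have "\<gamma> C1_differentiable_on {-e<..<e}"
      unfolding C1_differentiable_on_def
      by (intro exI[of _ "\<lambda>t. F' (a + t *\<^sub>R w) w"]) (auto intro!: \<gamma>' continuous_intros)
    moreover have "\<gamma> ` {-e<..<e} \<subseteq> X"
      using \<gamma>N(1) N(1) openin_imp_subset by blast
    moreover have "\<gamma> 0 = x" by (simp add: \<gamma>_def Fa)
    moreover have \<gamma>0: "(\<gamma> has_vector_derivative F' a w) (at 0)"
      using \<gamma>'[of 0] e by simp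
    ultimately show "F' a w \<in> tangent_space X x"
      unfolding tangent_space_def using e by blast
    \<comment> \<open>The velocity of \<open>G \<circ> \<gamma>\<close> at 0 is computed twice: by
      the chain rule, and from the fact that the chart turns \<open>\<gamma>\<close> back into a
      straight line with direction \<open>w\<close>.\<close>
    have "((G \<circ> \<gamma>) has_vector_derivative G' x (F' a w)) (at 0)"
      using vector_derivative_diff_chain_within[OF \<gamma>0] has_derivative_at_withinI[OF G[OF K(2)]]
        \<open>\<gamma> 0 = x\<close> by auto
    moreover have "((G \<circ> \<gamma>) has_vector_derivative w) (at 0)"
    proof (rule has_vector_derivative_transform_within_open[where S = "{-e<..<e}"])
      show "((\<lambda>t. a + t *\<^sub>R w) has_vector_derivative w) (at 0)"
        by (auto intro!: derivative_eq_intros)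
      show "a + t *\<^sub>R w = (G \<circ> \<gamma>) t" if "t \<in> {-e<..<e}" for t
        using \<gamma>N[OF that] inK[OF that] G\<phi>[of "\<gamma> t"] by (simp add: \<gamma>_def)
    qed (use e in auto)
    ultimately show "G' x (F' a w) = w"
      by (rule vector_derivative_unique_at)
  qed
  have lin: "linear (blinfun_apply (F' a))"
    by (simp add: blinfun.bounded_linear_right bounded_linear.linear)
  have "inj_on (blinfun_apply (F' a)) (span P)"
    using inverse P(1) by (metis inj_on_inverseI span_eq_iff)
  then have "dim (blinfun_apply (F' a) ` P) = m"
    using dim_image_eq[OF lin] P(2) by blast
  moreover have "subspace (blinfun_apply (F' a) ` P)"
    using lin P(1) by (rule linear_subspace_image)
  ultimately show thesis using that tangent by blast
qed

section \<open>Normal directions and supporting functionals of sublevel sets\<close>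

text \<open>By dimension, \<open>T\<close> is the whole hyperplane orthogonal to \<open>q\<close>,
  so it contains the component of \<open>p\<close> orthogonal to \<open>q\<close>; that component is
  then orthogonal to itself.\<close>

lemma orthogonal_to_hyperplane_collinear:
  fixes p q :: "'a::euclidean_space"
  assumes "subspace T" "dim T = DIM('a) - 1" "q \<noteq> 0"
    and "\<And>v. v \<in> T \<Longrightarrow> q \<bullet> v = 0" "\<And>v. v \<in> T \<Longrightarrow> p \<bullet> v = 0"
  obtains c where "p = c *\<^sub>R q"
proof -
  have "T = {v. q \<bullet> v = 0}"
    using assms by (intro subspace_dim_equal) (auto simp: subspace_hyperplane dim_hyperplane)
  moreover define v where "v = p - (p \<bullet> q / (q \<bullet> q)) *\<^sub>R q"
  moreover have "q \<bullet> v = 0"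
    using assms(3) by (simp add: v_def inner_diff_right inner_commute)
  ultimately have "v \<bullet> v = 0"
    using assms(5)[of v] by (simp add: v_def inner_diff_left)
  then show thesis using that by (simp add: v_def)
qed

text \<open>Since \<open>u\<close> has no local minimum, a level set lies in the closure of its strict sublevel set;
  a supporting functional of the latter is therefore extremal along curves in the level set.\<close>

lemma regular_solution_support:
  fixes a x :: "'a::euclidean_space"
  assumes reg: "regular_solution U g U u" and x: "x \<in> U" and gx: "g x \<noteq> 0" and a: "a \<noteq> 0"
    and supp: "\<And>y. y \<in> U \<Longrightarrow> u y < u x \<Longrightarrow> a \<bullet> y \<le> a \<bullet> x"
  obtains c where "c > 0" "a = c *\<^sub>R g x"
proof -
  let ?L = "level_set U u x"
  have norm: "normal_solution U g U u" using reg by (simp add: regular_solution_def)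
  have level: "a \<bullet> z \<le> a \<bullet> x" if "z \<in> ?L" for z
  proof -
    have z: "z \<in> U" "u z = u x" using that by (auto simp: level_set_def)
    have "\<not> local_min_point U u z" using norm by (auto simp: normal_solution_def)
    then have "frequently (\<lambda>y. u y < u z) (at z within U)"
      using z by (simp add: local_min_point_def not_eventually not_le)
    then have "z \<in> closure {y \<in> U. u y < u x}"
      using z by (fastforce simp: frequently_at closure_approachable)
    also have "\<dots> \<subseteq> {y. a \<bullet> y \<le> a \<bullet> x}"
      by (intro closure_minimal closed_halfspace_le) (use supp in auto)
    finally show ?thesis by simp
  qed
  have a_tangent: "a \<bullet> v = 0" if v: "v \<in> tangent_space ?L x" for v
  proof -
    obtain e \<gamma> where e: "e > 0" "\<gamma> ` {-e<..<e} \<subseteq> ?L" "\<gamma> 0 = x"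
      and der: "(\<gamma> has_vector_derivative v) (at 0)"
      using v unfolding tangent_space_def by blast
    have "((\<lambda>t. a \<bullet> \<gamma> t) has_vector_derivative a \<bullet> v) (at 0)"
      using bounded_linear.has_vector_derivative[OF bounded_linear_inner_right der] .
    then have "((\<lambda>t. a \<bullet> \<gamma> t) has_real_derivative a \<bullet> v) (at 0)"
      by (simp add: has_real_derivative_iff_has_vector_derivative)
    moreover have "\<forall>t. \<bar>0 - t\<bar> < e \<longrightarrow> a \<bullet> \<gamma> t \<le> a \<bullet> \<gamma> 0"
    proof (intro allI impI)
      fix t assume "\<bar>0 - t\<bar> < e"
      then have "\<gamma> t \<in> ?L" using e(2) by (auto simp: image_subset_iff abs_less_iff)
      then show "a \<bullet> \<gamma> t \<le> a \<bullet> \<gamma> 0" using level e(3) by simp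
    qed
    ultimately show ?thesis using e(1) DERIV_local_max by blast
  qed
  have xL: "x \<in> ?L" using x by (simp add: level_set_def)
  have "C1_manifold (DIM('a) - 1) ?L" using norm x by (auto simp: normal_solution_def)
  then obtain T where T: "subspace T" "dim T = DIM('a) - 1" "T \<subseteq> tangent_space ?L x"
    using xL tangent_space_contains_subspace by metis
  have "g x \<bullet> v = 0" if "v \<in> T" for v
    using norm x xL T(3) that by (auto simp: normal_solution_def normal_vector_field_def)
  then obtain c where c: "a = c *\<^sub>R g x"
    using orthogonal_to_hyperplane_collinear[OF T(1,2) gx] a_tangent T(3) by (metis subsetD)
  obtain r s where rs: "r < 0" "0 < s" "\<forall>t\<in>{r<..<s}. x + t *\<^sub>R g x \<in> U"
    "strict_mono_on {r<..<s} (\<lambda>t. u (x + t *\<^sub>R g x))"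
    using reg x unfolding regular_solution_def by metis
  \<comment> \<open>Moving backwards along \<open>g x\<close> strictly lowers \<open>u\<close>, so
    \<open>supp\<close> applies at the point for \<open>r/2\<close>; this rules out a negative
    \<open>c\<close>.\<close>
  have "u (x + (r/2) *\<^sub>R g x) < u (x + 0 *\<^sub>R g x)"
    by (rule strict_mono_onD[OF rs(4)]) (use rs in auto)
  then have "a \<bullet> (x + (r/2) *\<^sub>R g x) \<le> a \<bullet> x"
    using rs by (intro supp) auto
  then have "(r * c) * (g x \<bullet> g x) \<le> 0" by (simp add: c inner_add_right mult.assoc mult.left_commute)
  moreover have "g x \<bullet> g x > 0" using gx by simp
  ultimately have "r * c \<le> 0" by (metis mult_pos_pos not_le)
  then have "c \<ge> 0" using rs(1) by (simp add: mult_le_0_iff)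
  moreover have "c \<noteq> 0" using a c by auto
  ultimately have "c > 0" by simp
  then show thesis using that c by blast
qed

text \<open>The strict sublevel set \<open>S\<close> of \<open>u\<close> at \<open>x\<close> is open
  by continuity, convex by quasi-convexity, and disjoint from \<open>F\<close> by minimality of
  \<open>x\<close>. A hyperplane separating the two passes through \<open>x\<close> and has a
  positive multiple of \<open>g x\<close> as normal. Sufficiency takes \<open>F = {x}\<close>,
  necessity the feasible set.\<close>

lemma regular_solution_normal_separates:
  fixes x :: "'a::euclidean_space"
  assumes "open U" "convex U" "regular_solution U g U u" "g x \<noteq> 0" "quasiconvex_on U u" "x \<in> U"
    and "convex F" "F \<subseteq> U" "x \<in> F" and min: "\<And>y. y \<in> F \<Longrightarrow> u x \<le> u y"
  shows "\<forall>y\<in>U. u y < u x \<longrightarrow> g x \<bullet> y < g x \<bullet> x" and "\<forall>y\<in>F. g x \<bullet> x \<le> g x \<bullet> y"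
proof -
  define S where "S = {y \<in> U. u y < u x}"
  have norm: "normal_solution U g U u" using assms(3) by (simp add: regular_solution_def)
  have "continuous_on U u"
    using norm by (auto simp: normal_solution_def intro: locally_lipschitz_on_imp_continuous_on)
  then have "open S"
    using continuous_open_preimage[OF _ assms(1) open_lessThan, of u "u x"]
    by (simp add: S_def Int_def vimage_def)
  have "convex S"
    unfolding convex_alt S_def
  proof (intro ballI allI impI)
    fix y z and t :: real assume *: "y \<in> {y \<in> U. u y < u x}" "z \<in> {y \<in> U. u y < u x}" "0 \<le> t \<and> t \<le> 1"
    then have "u ((1 - t) *\<^sub>R y + t *\<^sub>R z) \<le> max (u y) (u z)"
      using assms(5) by (auto simp: quasiconvex_on_def)
    moreover have "(1 - t) *\<^sub>R y + t *\<^sub>R z \<in> U"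
      using * assms(2) by (auto simp: convex_alt)
    ultimately show "(1 - t) *\<^sub>R y + t *\<^sub>R z \<in> {y \<in> U. u y < u x}"
      using * by auto
  qed
  have "\<not> local_min_point U u x" using norm by (auto simp: normal_solution_def)
  then have "frequently (\<lambda>y. u y < u x) (at x within U)"
    using assms(6) by (simp add: local_min_point_def not_eventually not_le)
  then have cl: "x \<in> closure S"
    by (fastforce simp: frequently_at closure_approachable S_def)
  then have "S \<noteq> {}" by auto
  moreover have "S \<inter> F = {}" using min by (force simp: S_def)
  ultimately obtain a b where ab: "a \<noteq> 0" "\<forall>y\<in>S. a \<bullet> y \<le> b" "\<forall>y\<in>F. b \<le> a \<bullet> y"
    using separating_hyperplane_sets[OF \<open>convex S\<close> assms(7)] assms(9) by blast
  \<comment> \<open>As \<open>x\<close> lies in \<open>F\<close>,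
    \<open>b \<le> a \<bullet> x\<close>; hence \<open>a\<close> supports \<open>S\<close> at
    \<open>x\<close>.\<close>
  then obtain c where c: "c > 0" "a = c *\<^sub>R g x"
    using regular_solution_support[OF assms(3,6,4) ab(1)] assms(9) unfolding S_def
    by (metis (mono_tags, lifting) mem_Collect_eq order_trans)
  \<comment> \<open>The point \<open>x\<close> lies both in the closure of \<open>S\<close> and in
    \<open>F\<close>, which fixes the level \<open>b\<close>.\<close>
  have "closure S \<subseteq> {y. a \<bullet> y \<le> b}"
    using ab(2) by (intro closure_minimal closed_halfspace_le) auto
  then have b: "b = a \<bullet> x" using cl ab(3) assms(9) by force
  show "\<forall>y\<in>F. g x \<bullet> x \<le> g x \<bullet> y"
    using ab(3) c by (simp add: b)
  \<comment> \<open>Openness of \<open>S\<close> makes the inequality strict, the interior of the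
    closed half-space being the open one.\<close>
  have "interior S \<subseteq> interior {y. a \<bullet> y \<le> b}"
    using ab(2) by (intro interior_mono) auto
  then have "S \<subseteq> {y. a \<bullet> y < b}"
    using \<open>open S\<close> ab(1) by (simp add: interior_open)
  then show "\<forall>y\<in>U. u y < u x \<longrightarrow> g x \<bullet> y < g x \<bullet> x"
    using c by (auto simp: S_def b)
qed

section \<open>Lagrange multipliers for convex programs\<close>

text \<open>Points with \<open>h y > 0\<close> bound an admissible \<open>l\<close> from below by
  \<open>(m - f y) / h y\<close>, points with \<open>h w < 0\<close> from above by
  \<open>(f w - m) / (- h w)\<close>. Convexity puts every lower bound below every upper one, so the
  supremum of the lower bounds works; the Slater point \<open>z\<close> keeps it finite.\<close>

lemma convex_on_single_multiplier:
  assumes f: "convex_on C f" and h: "convex_on C h" and z: "z \<in> C" "h z < (0::real)"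
    and min: "\<And>y. y \<in> C \<Longrightarrow> h y \<le> 0 \<Longrightarrow> m \<le> f y"
  obtains l where "l \<ge> 0" "\<And>y. y \<in> C \<Longrightarrow> m \<le> f y + l * h y"
proof -
  have cross: "(m - f y) / h y \<le> (f w - m) / (- h w)"
    if y: "y \<in> C" "h y > 0" and w: "w \<in> C" "h w < 0" for y w
  proof -
    define s where "s = h y - h w"
    have s: "s > 0" using y w by (simp add: s_def)
    \<comment> \<open>This weight makes the chord of \<open>h\<close> from \<open>w\<close> to
      \<open>y\<close> vanish at \<open>?p\<close>, so \<open>?p\<close> is feasible by
      convexity.\<close>
    define t where "t = - h w / s"
    have t: "0 \<le> t" "t \<le> 1" "1 - t = h y / s" using s y w by (auto simp: t_def s_def field_simps)
    let ?p = "(1 - t) *\<^sub>R w + t *\<^sub>R y"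
    have "?p \<in> C" using f w(1) y(1) t(1,2) unfolding convex_on_def convex_alt by blast
    moreover have "h ?p \<le> (1 - t) * h w + t * h y" using convex_onD[OF h t(1,2) w(1) y(1)] .
    then have "h ?p \<le> 0" unfolding t(3) by (simp add: t_def)
    ultimately have "m \<le> f ?p" using min by blast
    also have "\<dots> \<le> (1 - t) * f w + t * f y" using convex_onD[OF f t(1,2) w(1) y(1)] .
    finally have "m \<le> (h y * f w - h w * f y) / s"
      unfolding t(3) by (simp add: t_def diff_divide_distrib)
    then have "m * (h y - h w) \<le> h y * f w - h w * f y"
      using s by (simp add: pos_le_divide_eq s_def)
    then show ?thesis
      using y w by (simp add: field_simps)
  qed
  \<comment> \<open>The element 0 makes \<open>Sup Q\<close> nonnegative and keeps \<open>Q\<close>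
    nonempty when no point of \<open>C\<close> has \<open>h y > 0\<close>.\<close>
  define Q where "Q = insert 0 {(m - f y) / h y |y. y \<in> C \<and> h y > 0}"
  have ub: "q \<le> (f w - m) / (- h w)" if "q \<in> Q" "w \<in> C" "h w < 0" for q w
  proof -
    have "(f w - m) / (- h w) \<ge> 0"
      using min[of w] that by (intro divide_nonneg_pos) auto
    then show ?thesis using that cross unfolding Q_def by blast
  qed
  have Q: "Q \<noteq> {}" "bdd_above Q" using ub[OF _ z] by (auto simp: Q_def intro!: bdd_aboveI)
  show thesis
  proof
    show "Sup Q \<ge> 0" using Q by (intro cSup_upper) (auto simp: Q_def)
    fix y assume y: "y \<in> C"
    consider "h y > 0" | "h y = 0" | "h y < 0" by linarith
    then show "m \<le> f y + Sup Q * h y"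
    proof cases
      case 1
      then have "(m - f y) / h y \<le> Sup Q" using Q y by (intro cSup_upper) (auto simp: Q_def)
      then show ?thesis using 1 by (simp add: field_simps)
    next
      case 3
      then have "Sup Q \<le> (f y - m) / (- h y)" using Q y ub by (intro cSup_least) auto
      then show ?thesis using 3 by (simp add: field_simps)
    qed (use min y in auto)
  qed
qed

lemma convex_sublevel_Inter:
  assumes "convex U" "\<And>i. i \<in> I \<Longrightarrow> convex_on U (h i)"
  shows "convex {y \<in> U. \<forall>i\<in>I. h i y \<le> (0::real)}"
  unfolding convex_alt
proof (intro ballI allI impI)
  fix y z and t :: real
  assume *: "y \<in> {y \<in> U. \<forall>i\<in>I. h i y \<le> 0}" "z \<in> {y \<in> U. \<forall>i\<in>I. h i y \<le> 0}" "0 \<le> t \<and> t \<le> 1"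
  have "h i ((1 - t) *\<^sub>R y + t *\<^sub>R z) \<le> 0" if i: "i \<in> I" for i
  proof -
    have "h i ((1 - t) *\<^sub>R y + t *\<^sub>R z) \<le> (1 - t) * h i y + t * h i z"
      using * by (intro convex_onD[OF assms(2)[OF i]]) auto
    also have "\<dots> \<le> 0" using * i by (intro add_nonpos_nonpos mult_nonneg_nonpos) auto
    finally show ?thesis .
  qed
  then show "(1 - t) *\<^sub>R y + t *\<^sub>R z \<in> {y \<in> U. \<forall>i\<in>I. h i y \<le> 0}"
    using * assms(1) by (auto simp: convex_alt)
qed

text \<open>Constraint \<open>j\<close> gets its multiplier on \<open>C\<close>, where the other
  constraints hold, and is then absorbed into the objective, which stays convex. The induction
  hypothesis treats the remaining constraints for this new objective; hence the induction runs over
  arbitrary \<open>f\<close>.\<close>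

lemma convex_on_multipliers:
  assumes "finite I" "convex U" "convex_on U f" "\<And>i. i \<in> I \<Longrightarrow> convex_on U (h i)"
    and "z \<in> U" "\<And>i. i \<in> I \<Longrightarrow> h i z < (0::real)"
    and "\<And>y. y \<in> U \<Longrightarrow> \<forall>i\<in>I. h i y \<le> 0 \<Longrightarrow> m \<le> f y"
  shows "\<exists>l. (\<forall>i\<in>I. l i \<ge> 0) \<and> (\<forall>y\<in>U. m \<le> f y + (\<Sum>i\<in>I. l i * h i y))"
  using assms(1,3,4,6,7)
proof (induction I arbitrary: f)
  case (insert j I)
  define C where "C = {y \<in> U. \<forall>i\<in>I. h i y \<le> 0}"
  have C: "convex C" "C \<subseteq> U"
    unfolding C_def using insert.prems(2) assms(2) by (auto intro: convex_sublevel_Inter)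
  have "z \<in> C" using assms(5) insert.prems(3) by (auto simp: C_def less_imp_le)
  obtain r where r: "r \<ge> 0" "\<And>y. y \<in> C \<Longrightarrow> m \<le> f y + r * h j y"
  proof (rule convex_on_single_multiplier[of C f "h j" z m])
    show "convex_on C f" "convex_on C (h j)"
      using insert.prems(1,2) C by (auto intro: convex_on_subset)
  qed (use \<open>z \<in> C\<close> insert.prems(3,4) in \<open>auto simp: C_def\<close>)
  have "convex_on U (\<lambda>y. f y + r * h j y)"
    using r(1) insert.prems by (intro convex_on_add convex_on_cmul) auto
  then obtain l where l: "\<forall>i\<in>I. l i \<ge> 0" "\<forall>y\<in>U. m \<le> f y + r * h j y + (\<Sum>i\<in>I. l i * h i y)"
    using insert.IH[of "\<lambda>y. f y + r * h j y"] insert.prems r(2) by (auto simp: C_def)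
  have "(\<Sum>i\<in>I. (l(j := r)) i * h i y) = (\<Sum>i\<in>I. l i * h i y)" for y
    using insert.hyps by (intro sum.cong) auto
  then show ?case
    using l r(1) insert.hyps by (intro exI[of _ "l(j := r)"]) (auto simp: add.assoc)
qed auto

section \<open>Calculus of subdifferentials\<close>

text \<open>A hyperplane separates the epigraph of \<open>f\<close> from the strict hypograph of
  \<open>w\<close>; openness of \<open>U\<close> keeps it from being vertical, so it is the graph of
  an affine function. A one-point \<open>D\<close> yields subgradients, \<open>D = U\<close> the sum
  rule.\<close>

lemma convex_concave_sandwich:
  fixes f w :: "'a::euclidean_space \<Rightarrow> real"
  assumes U: "open U" and f: "convex_on U f" and w: "concave_on D w"
    and D: "D \<subseteq> U" "D \<noteq> {}" and le: "\<And>y. y \<in> D \<Longrightarrow> w y \<le> f y"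
  obtains q c where "\<And>y. y \<in> U \<Longrightarrow> q \<bullet> y + c \<le> f y" "\<And>y. y \<in> D \<Longrightarrow> w y \<le> q \<bullet> y + c"
proof -
  \<comment> \<open>Strictness keeps \<open>A\<close> disjoint from the epigraph also where
    \<open>w\<close> and \<open>f\<close> touch.\<close>
  define A where "A = {(y, r). y \<in> D \<and> r < w y}"
  have "convex A"
    unfolding convex_alt
  proof (intro ballI allI impI)
    fix p p' and t :: real assume *: "p \<in> A" "p' \<in> A" "0 \<le> t \<and> t \<le> 1"
    obtain y r y' r' where p: "p = (y, r)" "p' = (y', r')" by force
    have y: "y \<in> D" "y' \<in> D" "r < w y" "r' < w y'" using * by (auto simp: p A_def)
    have "(1 - t) * r + t * r' < (1 - t) * w y + t * w y'"
    \<comment> \<open>For \<open>t \<noteq> 0\<close> the second summand gives the strict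
      inequality; for \<open>t = 0\<close> it vanishes and the first one does.\<close>
    proof (cases "t = 0")
      case False
      then show ?thesis using * y by (intro add_le_less_mono mult_left_mono mult_strict_left_mono) auto
    qed (use y in auto)
    also have "\<dots> \<le> w ((1 - t) *\<^sub>R y + t *\<^sub>R y')"
      using concave_onD[OF w] * y by blast
    finally show "(1 - t) *\<^sub>R p + t *\<^sub>R p' \<in> A"
      using w y * by (auto simp: A_def p concave_on_iff convex_alt)
  qed
  moreover have "convex (epigraph U f)" using f by (rule convex_epigraphI)
  moreover obtain x where x: "x \<in> D" using D(2) by blast
  moreover have "(x, w x - 1) \<in> A" using x by (simp add: A_def)
  moreover have "(x, f x) \<in> epigraph U f" using x D(1) by (auto simp: epigraph_def)
  moreover have "A \<inter> epigraph U f = {}" using le by (force simp: A_def epigraph_def)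
  ultimately obtain p b where p: "p \<noteq> 0" "\<forall>v\<in>A. p \<bullet> v \<le> b" "\<forall>v\<in>epigraph U f. b \<le> p \<bullet> v"
    using separating_hyperplane_sets by (metis empty_iff)
  obtain a s where as: "p = (a, s)" by force
  have lower: "a \<bullet> y + s * r \<le> b" if "y \<in> D" "r < w y" for y r
    using p(2) that by (auto simp: as A_def)
  have upper: "b \<le> a \<bullet> y + s * r" if "y \<in> U" "f y \<le> r" for y r
    using p(3) that by (auto simp: as epigraph_def)
  \<comment> \<open>The epigraph lies above the hypograph over \<open>x\<close>, so
    \<open>s \<ge> 0\<close>. If \<open>s = 0\<close>, the half-space
    \<open>a \<bullet> y \<ge> b\<close> would contain the open set \<open>U\<close>, hence have
    \<open>x\<close> in its interior, while \<open>lower\<close> puts \<open>x\<close> on the other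
    side.\<close>
  have "s > 0"
  proof (rule ccontr)
    assume "\<not> s > 0"
    have "s \<ge> 0"
    proof -
      have "a \<bullet> x + s * (w x - 1) \<le> a \<bullet> x + s * f x"
        by (rule order_trans[OF lower upper]) (use x D(1) in auto)
      then have "s * (f x - w x + 1) \<ge> 0" by (simp add: algebra_simps)
      then show ?thesis using le[OF x] by (simp add: zero_le_mult_iff)
    qed
    then have "s = 0" using \<open>\<not> s > 0\<close> by simp
    then have "a \<noteq> 0" using p(1) by (simp add: as zero_prod_def)
    have "U \<subseteq> interior {y. a \<bullet> y \<ge> b}"
      using upper \<open>s = 0\<close> U by (intro interior_maximal) auto
    then have "a \<bullet> x > b" using x D(1) \<open>a \<noteq> 0\<close> by auto
    then show False using lower[OF x, of "w x - 1"] \<open>s = 0\<close> by simp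
  qed
  \<comment> \<open>The affine function arises from solving \<open>a \<bullet> y + s * r = b\<close>
    for \<open>r\<close>.\<close>
  show thesis
  proof
    fix y assume "y \<in> U"
    then have "b \<le> a \<bullet> y + s * f y" by (intro upper) auto
    then show "(- (1/s) *\<^sub>R a) \<bullet> y + b / s \<le> f y"
      using \<open>s > 0\<close> by (simp add: field_simps)
  next
    fix y assume "y \<in> D"
    show "w y \<le> (- (1/s) *\<^sub>R a) \<bullet> y + b / s"
    \<comment> \<open>The bound \<open>lower\<close> concerns only \<open>r < w y\<close>; the value
      \<open>w y\<close> is reached as a limit.\<close>
    proof (rule dense_le)
      fix r assume "r < w y"
      then show "r \<le> (- (1/s) *\<^sub>R a) \<bullet> y + b / s"
        using lower[OF \<open>y \<in> D\<close>, of r] \<open>s > 0\<close> by (simp add: field_simps)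
    qed
  qed
qed

lemma subdifferential_nonempty:
  fixes f :: "'a::euclidean_space \<Rightarrow> real"
  assumes "open U" "convex_on U f" "x \<in> U"
  shows "subdifferential U f x \<noteq> {}"
proof -
  have "concave_on {x} (\<lambda>_. f x)"
    by (auto simp: concave_on_iff simp flip: distrib_right)
  then obtain q c where "\<And>y. y \<in> U \<Longrightarrow> q \<bullet> y + c \<le> f y" "f x \<le> q \<bullet> x + c"
    using convex_concave_sandwich[OF assms(1,2), of "{x}" "\<lambda>_. f x"] assms(3) by auto
  then have "q \<in> subdifferential U f x"
    by (force simp: subdifferential_def inner_diff_right)
  then show ?thesis by blast
qed

text \<open>The subgradient inequality for \<open>p\<close> says that the concave function
  \<open>f x + h x - h y + p \<bullet> (y - x)\<close> of \<open>y\<close> lies below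
  \<open>f\<close>. An affine function between the two splits \<open>p\<close> into its slope
  \<open>q\<close>, a subgradient of \<open>f\<close>, and \<open>p - q\<close>, a subgradient of
  \<open>h\<close>.\<close>

lemma subdifferential_add:
  fixes f h :: "'a::euclidean_space \<Rightarrow> real"
  assumes "open U" "convex_on U f" "convex_on U h" "x \<in> U"
    and p: "p \<in> subdifferential U (\<lambda>y. f y + h y) x"
  shows "p \<in> subdifferential U f x + subdifferential U h x"
proof -
  have U: "convex U" using assms(2) by (simp add: convex_on_def)
  have "convex_on U (\<lambda>y. - (p \<bullet> (y - x)))"
    using U by (auto simp: convex_on_def algebra_simps inner_diff_right inner_add_right
        simp flip: distrib_right)
  then have "convex_on U (\<lambda>y. h y + - (p \<bullet> (y - x)))"
    using assms(3) by (rule convex_on_add[rotated])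
  moreover have "convex_on U (\<lambda>y. - (f x + h x))"
    using U by (auto simp: convex_on_def simp flip: distrib_right)
  ultimately have "convex_on U (\<lambda>y. h y + - (p \<bullet> (y - x)) + - (f x + h x))"
    by (rule convex_on_add)
  then have conc: "concave_on U (\<lambda>y. f x + h x - h y + p \<bullet> (y - x))"
    by (simp add: concave_on_def algebra_simps)
  obtain q c where q: "\<And>y. y \<in> U \<Longrightarrow> q \<bullet> y + c \<le> f y"
      "\<And>y. y \<in> U \<Longrightarrow> f x + h x - h y + p \<bullet> (y - x) \<le> q \<bullet> y + c"
  proof (rule convex_concave_sandwich[OF assms(1,2) conc])
    fix y assume "y \<in> U"
    then show "f x + h x - h y + p \<bullet> (y - x) \<le> f y"
      using p by (fastforce simp: subdifferential_def)
  qed (use assms(4) in auto)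
  \<comment> \<open>At \<open>x\<close> both bounds equal \<open>f x\<close>, so the affine function
    touches \<open>f\<close> and the concave function there.\<close>
  have "q \<bullet> x + c = f x" using q[OF assms(4)] by simp
  then have "q \<in> subdifferential U f x" "p - q \<in> subdifferential U h x"
    using q by (fastforce simp: subdifferential_def inner_diff_right inner_diff_left)+
  then have "q + (p - q) \<in> subdifferential U f x + subdifferential U h x"
    by (rule set_plus_intro)
  then show ?thesis by simp
qed

lemma subdifferential_const:
  fixes x :: "'a::euclidean_space"
  assumes "open U" "x \<in> U"
  shows "subdifferential U (\<lambda>_. c) x = {0}"
proof -
  have "p = 0" if "p \<in> subdifferential U (\<lambda>_. c) x" for p
  proof (rule ccontr)
    assume "p \<noteq> 0"
    \<comment> \<open>A nonzero linear function has no maximum on an open set.\<close>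
    have "U \<subseteq> interior {y. p \<bullet> y \<le> p \<bullet> x}"
      using that assms(1) by (intro interior_maximal)
        (auto simp: subdifferential_def inner_diff_right)
    then show False using assms(2) \<open>p \<noteq> 0\<close> by auto
  qed
  then show ?thesis by (auto simp: subdifferential_def)
qed

text \<open>A positive factor rescales the inequality. For \<open>c = 0\<close> the right-hand side
  is \<open>{0}\<close> only because a subgradient exists.\<close>

lemma subdifferential_cmul:
  fixes f :: "'a::euclidean_space \<Rightarrow> real"
  assumes "open U" "convex_on U f" "x \<in> U" "c \<ge> 0"
  shows "subdifferential U (\<lambda>y. c * f y) x = (\<lambda>p. c *\<^sub>R p) ` subdifferential U f x"
proof (cases "c = 0")
  case True
  then show ?thesis
    using subdifferential_nonempty[OF assms(1-3)] subdifferential_const[OF assms(1,3)] by auto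
next
  case False
  then have c: "c > 0" using assms(4) by simp
  show ?thesis
  proof (intro equalityI subsetI)
    fix p assume p: "p \<in> subdifferential U (\<lambda>y. c * f y) x"
    have "(1/c) *\<^sub>R p \<in> subdifferential U f x"
      using p c by (auto simp: subdifferential_def field_simps)
    moreover have "p = c *\<^sub>R ((1/c) *\<^sub>R p)" using c by simp
    ultimately show "p \<in> (\<lambda>p. c *\<^sub>R p) ` subdifferential U f x" by (rule rev_image_eqI)
  next
    fix p assume "p \<in> (\<lambda>p. c *\<^sub>R p) ` subdifferential U f x"
    then obtain q where q: "p = c *\<^sub>R q" "q \<in> subdifferential U f x" by blast
    have "c * (q \<bullet> (y - x)) \<le> c * (f y - f x)" if "y \<in> U" for y
      using q(2) that c by (intro mult_left_mono) (auto simp: subdifferential_def)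
    then show "p \<in> subdifferential U (\<lambda>y. c * f y) x"
      by (auto simp: subdifferential_def q(1) right_diff_distrib)
  qed
qed

lemma convex_on_sum_fun:
  assumes "finite I" "convex U" "\<forall>i\<in>I. convex_on U (f i)"
  shows "convex_on U (\<lambda>y. \<Sum>i\<in>I. f i y)"
  using assms
proof (induction I)
  case empty
  then show ?case by (simp add: convex_on_def)
qed (auto intro: convex_on_add)

lemma subdifferential_sum:
  fixes f :: "'i \<Rightarrow> 'a::euclidean_space \<Rightarrow> real"
  assumes "open U" "convex U" "finite I" "\<And>i. i \<in> I \<Longrightarrow> convex_on U (f i)" "x \<in> U"
    and "p \<in> subdifferential U (\<lambda>y. \<Sum>i\<in>I. f i y) x"
  shows "p \<in> (\<Sum>i\<in>I. subdifferential U (f i) x)"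
  using assms(3,4,6)
proof (induction I arbitrary: p)
  case empty
  then show ?case using subdifferential_const[OF assms(1,5)] by (simp add: set_zero)
next
  case (insert j I)
  have "convex_on U (\<lambda>y. \<Sum>i\<in>I. f i y)"
    using assms(2) insert.hyps(1) insert.prems(1) by (intro convex_on_sum_fun) auto
  then have "p \<in> subdifferential U (f j) x + subdifferential U (\<lambda>y. \<Sum>i\<in>I. f i y) x"
    using insert assms(1,5) by (intro subdifferential_add) auto
  also have "\<dots> \<subseteq> subdifferential U (f j) x + (\<Sum>i\<in>I. subdifferential U (f i) x)"
    using insert by (intro set_plus_mono2) auto
  finally show ?case using insert.hyps by simp
qed

text \<open>Adding the subgradient inequalities gives this converse of the sum rule, the direction
  that sufficiency uses.\<close>

lemma subdifferential_sum_subset: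
  assumes "finite I" "p \<in> (\<Sum>i\<in>I. subdifferential U (f i) x)"
  shows "p \<in> subdifferential U (\<lambda>y. \<Sum>i\<in>I. f i y) x"
  using assms
proof (induction I arbitrary: p)
  case empty
  then show ?case by (simp add: subdifferential_def set_zero)
next
  case (insert j I)
  then obtain q r where p: "p = q + r" "q \<in> subdifferential U (f j) x"
    "r \<in> subdifferential U (\<lambda>y. \<Sum>i\<in>I. f i y) x"
    by (auto elim!: set_plus_elim)
  have "(q + r) \<bullet> (y - x) \<le> f j y + (\<Sum>i\<in>I. f i y) - (f j x + (\<Sum>i\<in>I. f i x))" if "y \<in> U" for y
    using p(2,3) that unfolding inner_add_left by (fastforce simp: subdifferential_def)
  then show ?case
    using insert.hyps by (simp add: subdifferential_def p(1))
qed

section \<open>The optimality conditions\<close>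

theorem theorem2:
  fixes U :: "'a::euclidean_space set"
    and k :: nat
    and h :: "nat \<Rightarrow> 'a \<Rightarrow> real"
    and g :: "'a \<Rightarrow> 'a"
    and u :: "'a \<Rightarrow> real"
    and x_plus x_star :: 'a
  assumes "open U" and "convex U"
    and "\<And>i. i \<in> {1..k} \<Longrightarrow> convex_on U (h i)"
    and "locally_lipschitz_on U g" and "\<And>x. x \<in> U \<Longrightarrow> g x \<noteq> 0"
    and "regular_solution U g U u"
    and "x_plus \<in> U" and "\<And>i. i \<in> {1..k} \<Longrightarrow> h i x_plus < 0"
    and "quasiconvex_on U u"
    and "x_star \<in> U"
  shows "is_arg_min u (\<lambda>x. x \<in> U \<and> (\<forall>i\<in>{1..k}. h i x \<le> 0)) x_star \<longleftrightarrow>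
    (\<forall>i\<in>{1..k}. h i x_star \<le> 0) \<and>
    (\<exists>l :: nat \<Rightarrow> real. (\<forall>i\<in>{1..k}. l i \<ge> 0) \<and>
       - g x_star \<in> (\<Sum>i = 1..k. (\<lambda>p. l i *\<^sub>R p) ` subdifferential U (h i) x_star) \<and>
       (\<forall>i\<in>{1..k}. l i * h i x_star = 0))"
    (is "?min \<longleftrightarrow> ?feas \<and> ?kkt")
proof -
  let ?x = x_star and ?G = "g x_star"
  define F where "F = {y \<in> U. \<forall>i\<in>{1..k}. h i y \<le> 0}"
  have "convex F" unfolding F_def using assms(2,3) by (rule convex_sublevel_Inter)
  note separates = regular_solution_normal_separates
      [OF assms(1,2,6) assms(5)[OF assms(10)] assms(9,10)]
  \<comment> \<open>Moving the multipliers into the functions prepares both directions of the sum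
    rule.\<close>
  have scaled: "(\<Sum>i = 1..k. (\<lambda>p. l i *\<^sub>R p) ` subdifferential U (h i) ?x)
      = (\<Sum>i = 1..k. subdifferential U (\<lambda>y. l i * h i y) ?x)"
    if "\<forall>i\<in>{1..k}. l i \<ge> 0" for l
    using assms that by (intro sum.cong) (simp_all add: subdifferential_cmul)
  show ?thesis
  proof (intro iffI conjI)
    assume ?min
    then show feas: ?feas by (simp add: is_arg_min_linorder)
    have "\<forall>y\<in>F. ?G \<bullet> ?x \<le> ?G \<bullet> y"
      using \<open>?min\<close> feas assms(10) \<open>convex F\<close>
      by (intro separates) (auto simp: F_def is_arg_min_linorder)
    moreover have "convex_on U (\<lambda>y. ?G \<bullet> y)"
      using assms(2) by (auto simp: convex_on_def inner_add_right)
    ultimately obtain l where l: "\<forall>i\<in>{1..k}. l i \<ge> 0"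
        "\<forall>y\<in>U. ?G \<bullet> ?x \<le> ?G \<bullet> y + (\<Sum>i\<in>{1..k}. l i * h i y)"
      using convex_on_multipliers[of "{1..k}" U "\<lambda>y. ?G \<bullet> y" h x_plus "?G \<bullet> ?x"] assms
      by (auto simp: F_def)
    have nonpos: "l i * h i ?x \<le> 0" if "i \<in> {1..k}" for i
      using l(1) feas that by (auto simp: mult_le_0_iff)
    \<comment> \<open>The multiplier inequality at \<open>x_star\<close> itself bounds the sum below
      by 0, while every term is at most 0.\<close>
    have zero: "(\<Sum>i\<in>{1..k}. l i * h i ?x) = 0"
      using l(2) assms(10) sum_nonpos[of "{1..k}", OF nonpos] by force
    with nonpos have slack: "\<forall>i\<in>{1..k}. l i * h i ?x = 0"
      using sum_nonneg_eq_0_iff[of "{1..k}" "\<lambda>i. - (l i * h i ?x)"] by (simp add: sum_negf)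
    \<comment> \<open>As the sum vanishes at \<open>x_star\<close>, the multiplier inequality is
      exactly a subgradient inequality for \<open>- ?G\<close>.\<close>
    have "- ?G \<in> subdifferential U (\<lambda>y. \<Sum>i\<in>{1..k}. l i * h i y) ?x"
      using l(2) zero by (auto simp: subdifferential_def inner_diff_right)
    then have "- ?G \<in> (\<Sum>i\<in>{1..k}. subdifferential U (\<lambda>y. l i * h i y) ?x)"
      using assms l(1) by (intro subdifferential_sum) auto
    then have "- ?G \<in> (\<Sum>i = 1..k. (\<lambda>p. l i *\<^sub>R p) ` subdifferential U (h i) ?x)"
      unfolding scaled[OF l(1)] .
    then show ?kkt using l(1) slack by blast
  next
    assume *: "?feas \<and> ?kkt"
    then obtain l where l: "\<forall>i\<in>{1..k}. l i \<ge> 0" "\<forall>i\<in>{1..k}. l i * h i ?x = 0"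
        "- ?G \<in> (\<Sum>i = 1..k. (\<lambda>p. l i *\<^sub>R p) ` subdifferential U (h i) ?x)" by blast
    have sub: "- ?G \<in> subdifferential U (\<lambda>y. \<Sum>i = 1..k. l i * h i y) ?x"
      using l(3) scaled[OF l(1)] by (simp add: subdifferential_sum_subset)
    have "u ?x \<le> u y" if y: "y \<in> U" "\<forall>i\<in>{1..k}. h i y \<le> 0" for y
    proof (rule ccontr)
      assume "\<not> u ?x \<le> u y"
      then have "?G \<bullet> y < ?G \<bullet> ?x"
        \<comment> \<open>Over the single point \<open>x_star\<close> minimality is trivial.\<close>
        using separates(1)[of "{?x}"] assms(10) y by auto
      \<comment> \<open>Complementary slackness removes the value of the sum at
        \<open>x_star\<close>; feasibility of \<open>y\<close> then gives
        \<open>?G \<bullet> y \<ge> ?G \<bullet> ?x\<close>, a contradiction.\<close>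
      moreover have "- ?G \<bullet> (y - ?x) \<le> (\<Sum>i = 1..k. l i * h i y)"
        using sub y l(2) by (auto simp: subdifferential_def)
      moreover have "\<dots> \<le> 0"
        using l(1) y by (intro sum_nonpos) (auto simp: mult_le_0_iff)
      ultimately show False by (simp add: inner_diff_right)
    qed
    then show ?min using * assms(10) by (simp add: is_arg_min_linorder)
  qed
qed

end
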